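(* Let $R$ be a ring, let $n$ be a positive integer, let $\sigma\colon R\to M_n(R)$ be a ring homomorphism, let $\delta\colon R\to R^n$ be a right $\sigma$-derivation and let $\deg$ be the pseudo-valuation on the $(\sigma,\delta)$-free skew extension $S=R\langle x_1,\dots,x_n;\sigma,\delta\rangle$ of $R$ given by $\deg(f)=\min\{m\mid f\in S_m\}$. Then $\deg$ is a degree-function if, and only if, $\sigma$ is megainjective.
   Context: Rings are associative with identity element; ring homomorphisms preserve the identity; modules are unital. $R^n$ denotes row vectors with $n$ entries in $R$. For a ring homomorphism $\sigma\colon R\to M_n(R)$, a right $\sigma$-derivation is an additive map $\delta\colon R\to R^n$ with $\delta(rs)=\delta(r)\sigma(s)+r\delta(s)$ for all $r,s\in R$ (matrix product in the first term). Write $\sigma_{ij}(r)$ for the $(i,j)$-entry of $\sigma(r)$ and $\delta_j(r)$ for the $j$-th component of $\delta(r)$. The $(\sigma,\delta)$-free skew extension $S=R\langle x_1,\dots,x_n;\sigma,\delta\rangle$ of $R$ is a ring (unique up to isomorphism) containing $R$ as a subring and an $n$-element subset $X=\{x_1,\dots,x_n\}$ such that (i) the submonoid $\langle X\rangle$ of the multiplicative monoid of $S$ generated by $X$ is free on $X$; (ii) $S$ is a free right $R$-module with basis $\langle X\rangle$; (iii) $rx_j=\sum_{i=1}^n x_i\sigma_{ij}(r)+\delta_j(r)$ for all $j$ and all $r\in R$. The length of $w=x_{i_1}\cdots x_{i_r}\in\langle X\rangle$ is $|w|=r$, with $|1|=0$. For $m\ge 0$, $S_m$ is the right $R$-submodule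 of $S$ generated by all monomials in $\langle X\rangle$ of length $\le m$, and $S_{-\infty}=\{0\}$. The function $\deg\colon S\to\mathbb{N}\cup\{-\infty\}$, $\deg(f)=\min\{m\mid f\in S_m\}$, is a pseudo-valuation: $\deg(f)\ge 0$ for $f\ne 0$, $\deg(0)=-\infty$, $\deg(f-g)\le\max\{\deg f,\deg g\}$, $\deg(fg)\le\deg f+\deg g$, $\deg(1)=0$. It is called a degree-function if $\deg(fg)=\deg(f)+\deg(g)$ for all $f,g\in S$. Define ring homomorphisms $\sigma^{(r)}\colon R\to M_{n^r}(R)$, $r\ge 1$, by $\sigma^{(1)}=\sigma$ and, if $\sigma^{(r)}(a)=(a_{kl})$, then $\sigma^{(r+1)}(a)$ is the $n^{r+1}\times n^{r+1}$ matrix whose $(k,l)$ block of size $n\times n$ is $\sigma(a_{kl})$. The homomorphism $\sigma$ is megainjective if for all $a\in R\setminus\{0\}$ and $r\ge 1$, $\sigma^{(r)}(a)$ is neither the zero matrix nor a left zero divisor in $M_{n^r}(R)$; equivalently, the columns of $\sigma^{(r)}(a)$ are right $R$-linearly independent. *)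

theory Defs
  imports "Jordan_Normal_Form.Matrix" "HOL-Library.Extended"
begin

section \<open>Matrix-valued ring homomorphisms and skew derivations\<close>

definition is_mat_hom :: "nat \<Rightarrow> ('a::ring_1 \<Rightarrow> 'a mat) \<Rightarrow> bool" where
  "is_mat_hom n \<sigma> \<longleftrightarrow>
     (\<forall>r. \<sigma> r \<in> carrier_mat n n) \<and>
     \<sigma> 1 = 1\<^sub>m n \<and>
     (\<forall>r s. \<sigma> (r + s) = \<sigma> r + \<sigma> s) \<and>
     (\<forall>r s. \<sigma> (r * s) = \<sigma> r * \<sigma> s)"

definition vec_times_mat :: "'a::ring_1 vec \<Rightarrow> 'a mat \<Rightarrow> 'a vec" where
  "vec_times_mat v A = row (mat_of_row v * A) 0"

definition is_right_derivation ::
    "nat \<Rightarrow> ('a::ring_1 \<Rightarrow> 'a mat) \<Rightarrow> ('a \<Rightarrow> 'a vec) \<Rightarrow> bool" where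
  "is_right_derivation n \<sigma> \<delta> \<longleftrightarrow>
     (\<forall>r. \<delta> r \<in> carrier_vec n) \<and>
     (\<forall>r s. \<delta> (r + s) = \<delta> r + \<delta> s) \<and>
     (\<forall>r s. \<delta> (r * s) = vec_times_mat (\<delta> r) (\<sigma> s) + r \<cdot>\<^sub>v \<delta> s)"

text \<open>
  Replaces every entry \<open>b\<close> of a matrix by the \<open>n \<times> n\<close> block \<open>\<sigma> b\<close>; rows and columns are
  numbered from \<open>0\<close>, so position \<open>(i, j)\<close> lies in block \<open>(i div n, j div n)\<close>.
\<close>
definition block_map :: "nat \<Rightarrow> ('a \<Rightarrow> 'a mat) \<Rightarrow> 'a mat \<Rightarrow> 'a mat" where
  "block_map n \<sigma> A =
     mat (dim_row A * n) (dim_col A * n)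
       (\<lambda>(i, j). \<sigma> (A $$ (i div n, j div n)) $$ (i mod n, j mod n))"

text \<open>
  \<open>sigma_iter n \<sigma> r\<close> is \<open>\<sigma>\<^sup>(\<^sup>r\<^sup>)\<close>, of size \<open>n ^ r\<close>. Only \<open>r \<ge> 1\<close> is ever used;
  the value at \<open>0\<close> is the evident convention.
\<close>
fun sigma_iter :: "nat \<Rightarrow> ('a \<Rightarrow> 'a mat) \<Rightarrow> nat \<Rightarrow> 'a \<Rightarrow> 'a mat" where
  "sigma_iter n \<sigma> 0 a = mat 1 1 (\<lambda>_. a)"
| "sigma_iter n \<sigma> (Suc 0) a = \<sigma> a"
| "sigma_iter n \<sigma> (Suc (Suc r)) a = block_map n \<sigma> (sigma_iter n \<sigma> (Suc r) a)"

definition left_zero_divisor_mat :: "nat \<Rightarrow> 'a::ring_1 mat \<Rightarrow> bool" where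
  "left_zero_divisor_mat N A \<longleftrightarrow>
     (\<exists>B \<in> carrier_mat N N. B \<noteq> 0\<^sub>m N N \<and> A * B = 0\<^sub>m N N)"

definition megainjective :: "nat \<Rightarrow> ('a::ring_1 \<Rightarrow> 'a mat) \<Rightarrow> bool" where
  "megainjective n \<sigma> \<longleftrightarrow>
     (\<forall>a r. a \<noteq> 0 \<longrightarrow> r \<ge> 1 \<longrightarrow>
        sigma_iter n \<sigma> r a \<noteq> 0\<^sub>m (n ^ r) (n ^ r) \<and>
        \<not> left_zero_divisor_mat (n ^ r) (sigma_iter n \<sigma> r a))"


section \<open>Free skew extensions\<close>

text \<open>
  The inclusion of the subring \<open>R\<close> in \<open>S\<close> is an injective ring homomorphism \<open>\<iota>\<close>, and \<open>S\<close> is the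
  right \<open>R\<close>-module with action \<open>f \<cdot> c = f * \<iota> c\<close>. The library modules are over commutative rings
  only, hence the separate notions of span, independence and basis below.
\<close>

definition right_span :: "('a::ring_1 \<Rightarrow> 's::ring_1) \<Rightarrow> 's set \<Rightarrow> 's set" where
  "right_span \<iota> B = {(\<Sum>b\<in>A. b * \<iota> (c b)) | A c. finite A \<and> A \<subseteq> B}"

definition right_independent :: "('a::ring_1 \<Rightarrow> 's::ring_1) \<Rightarrow> 's set \<Rightarrow> bool" where
  "right_independent \<iota> B \<longleftrightarrow>
     (\<forall>A c. finite A \<longrightarrow> A \<subseteq> B \<longrightarrow> (\<Sum>b\<in>A. b * \<iota> (c b)) = 0 \<longrightarrow> (\<forall>b\<in>A. c b = 0))"

definition is_right_basis :: "('a::ring_1 \<Rightarrow> 's::ring_1) \<Rightarrow> 's set \<Rightarrow> bool" where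
  "is_right_basis \<iota> B \<longleftrightarrow> right_independent \<iota> B \<and> right_span \<iota> B = UNIV"

definition generated_monoid :: "'s::monoid_mult set \<Rightarrow> 's set" where
  "generated_monoid X = prod_list ` lists X"

text \<open>Freeness on \<open>X\<close>: the canonical map from the free monoid of words over \<open>X\<close> is injective.\<close>
definition free_on :: "'s::monoid_mult set \<Rightarrow> bool" where
  "free_on X \<longleftrightarrow> inj_on prod_list (lists X)"

text \<open>
  The generators are \<open>x 0, \<dots>, x (n - 1)\<close>.
\<close>
definition is_free_skew_extension ::
    "nat \<Rightarrow> ('a::ring_1 \<Rightarrow> 'a mat) \<Rightarrow> ('a \<Rightarrow> 'a vec) \<Rightarrow> ('a \<Rightarrow> 's::ring_1) \<Rightarrow> (nat \<Rightarrow> 's) \<Rightarrow> bool" where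
  "is_free_skew_extension n \<sigma> \<delta> \<iota> x \<longleftrightarrow>
     inj_ring_hom \<iota> \<and>
     inj_on x {..<n} \<and>
     free_on (x ` {..<n}) \<and>
     is_right_basis \<iota> (generated_monoid (x ` {..<n})) \<and>
     (\<forall>r. \<forall>j<n. \<iota> r * x j = (\<Sum>i<n. x i * \<iota> (\<sigma> r $$ (i, j))) + \<iota> (\<delta> r $ j))"


section \<open>Degree\<close>

text \<open>
  \<open>\<nat> \<union> {-\<infinity>}\<close> is the part of \<^typ>\<open>nat extended\<close> without \<^term>\<open>Pinf\<close>; there
  addition and order are the usual ones, with \<open>-\<infinity> + m = -\<infinity>\<close>.
\<close>

definition monomials_upto :: "'s::monoid_mult set \<Rightarrow> nat \<Rightarrow> 's set" where
  "monomials_upto X m = {prod_list w | w. w \<in> lists X \<and> length w \<le> m}"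

text \<open>The value at \<^term>\<open>Pinf\<close> is irrelevant, as every element lies in some \<open>S\<^sub>m\<close>.\<close>
fun skew_filtration :: "('a::ring_1 \<Rightarrow> 's::ring_1) \<Rightarrow> 's set \<Rightarrow> nat extended \<Rightarrow> 's set" where
  "skew_filtration \<iota> X (Fin m) = right_span \<iota> (monomials_upto X m)"
| "skew_filtration \<iota> X Minf = {0}"
| "skew_filtration \<iota> X Pinf = UNIV"

definition skew_degree :: "('a::ring_1 \<Rightarrow> 's::ring_1) \<Rightarrow> 's set \<Rightarrow> 's \<Rightarrow> nat extended" where
  "skew_degree \<iota> X f = (LEAST m. f \<in> skew_filtration \<iota> X m)"

definition pseudo_valuation :: "('s::ring_1 \<Rightarrow> nat extended) \<Rightarrow> bool" where
  "pseudo_valuation d \<longleftrightarrow>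
     (\<forall>f. d f \<noteq> Pinf) \<and>
     (\<forall>f. f \<noteq> 0 \<longrightarrow> d f \<ge> 0) \<and>
     d 0 = Minf \<and>
     (\<forall>f g. d (f - g) \<le> max (d f) (d g)) \<and>
     (\<forall>f g. d (f * g) \<le> d f + d g) \<and>
     d 1 = 0"

definition degree_function :: "('s::ring_1 \<Rightarrow> nat extended) \<Rightarrow> bool" where
  "degree_function d \<longleftrightarrow> pseudo_valuation d \<and> (\<forall>f g. d (f * g) = d f + d g)"

end

theory Submission
  imports Defs
begin

text \<open>
  Moving a scalar \<open>a\<close> past a monomial \<open>w\<close> of length \<open>r\<close> gives, up to terms of length less than
  \<open>r\<close>, the sum of \<open>v \<sigma>\<^sup>(\<^sup>r\<^sup>)(a)\<^sub>v\<^sub>w\<close> over the monomials \<open>v\<close> of length \<open>r\<close>. So if \<open>f\<close> and \<open>g\<close>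
  have leading coefficients \<open>(c\<^sub>u)\<close> and \<open>(d\<^sub>w)\<close> in degrees \<open>p\<close> and \<open>q\<close>, the coefficient of \<open>u v\<close>
  in degree \<open>p + q\<close> of \<open>f g\<close> is entry \<open>v\<close> of the column \<open>\<sigma>\<^sup>(\<^sup>q\<^sup>)(c\<^sub>u) d\<close>. All of these vanish for
  some nonzero \<open>c\<close> and \<open>d\<close> exactly when some \<open>\<sigma>\<^sup>(\<^sup>q\<^sup>)(a)\<close> with \<open>a \<noteq> 0\<close> kills a
  nonzero column.
\<close>

section \<open>Words of fixed and of bounded length\<close>

definition words :: "nat \<Rightarrow> nat \<Rightarrow> nat list set" where
  "words n m = {w. set w \<subseteq> {..<n} \<and> length w = m}"

definition words_below :: "nat \<Rightarrow> nat \<Rightarrow> nat list set" where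
  "words_below n m = {w. set w \<subseteq> {..<n} \<and> length w < m}"

lemma finite_words [simp]: "finite (words n m)"
  unfolding words_def by (rule finite_lists_length_eq) simp

lemma finite_words_below [simp]: "finite (words_below n m)"
  by (rule finite_subset[OF _ finite_lists_length_le[of "{..<n}" m]]) (auto simp: words_below_def)

lemma words_0: "words n 0 = {[]}"
  by (auto simp: words_def)

lemma words_below_0 [simp]: "words_below n 0 = {}"
  by (auto simp: words_below_def)

lemma words_below_Suc: "words_below n (Suc m) = words_below n m \<union> words n m"
  by (auto simp: words_def words_below_def)

lemma words_below_disjoint: "words_below n m \<inter> words n m = {}"
  by (auto simp: words_def words_below_def)

lemma sum_words_Suc:
  "(\<Sum>w\<in>words n (Suc m). f w) = (\<Sum>i<n. \<Sum>v\<in>words n m. f (i # v))"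
proof -
  have "words n (Suc m) = (\<lambda>(i, v). i # v) ` ({..<n} \<times> words n m)"
    by (fastforce simp: words_def length_Suc_conv image_iff)
  moreover have "inj_on (\<lambda>(i, v). i # v) ({..<n} \<times> words n m)"
    by (auto simp: inj_on_def)
  ultimately show ?thesis
    by (simp add: sum.reindex sum.cartesian_product case_prod_unfold)
qed

lemma sum_words_append:
  "(\<Sum>w\<in>words n (p + q). f w) = (\<Sum>u\<in>words n p. \<Sum>v\<in>words n q. f (u @ v))"
proof -
  have "w \<in> (\<lambda>(u, v). u @ v) ` (words n p \<times> words n q)" if "w \<in> words n (p + q)" for w
  proof (rule image_eqI[of _ _ "(take p w, drop p w)"])
    show "(take p w, drop p w) \<in> words n p \<times> words n q"
      using that by (auto simp: words_def dest: in_set_takeD in_set_dropD)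
  qed simp
  hence "words n (p + q) = (\<lambda>(u, v). u @ v) ` (words n p \<times> words n q)"
    by (auto simp: words_def)
  moreover have "inj_on (\<lambda>(u, v). u @ v) (words n p \<times> words n q)"
    by (auto simp: inj_on_def words_def)
  ultimately show ?thesis
    by (simp add: sum.reindex sum.cartesian_product case_prod_unfold)
qed

section \<open>Iterates of \<sigma> with entries indexed by words, and megainjectivity\<close>

text \<open>The base-\<open>n\<close> digits of a row or column number, most significant first: with this
  numbering the blocks of \<^const>\<open>block_map\<close> refine the last letter of a word.\<close>
fun digits :: "nat \<Rightarrow> nat \<Rightarrow> nat \<Rightarrow> nat list" where
  "digits n 0 k = []"
| "digits n (Suc r) k = digits n r (k div n) @ [k mod n]"

lemma length_digits [simp]: "length (digits n r k) = r"
  by (induction r arbitrary: k) auto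

lemma digits_in_words: "n > 0 \<Longrightarrow> digits n r k \<in> words n r"
  by (induction r arbitrary: k) (auto simp: words_def)

lemma inj_on_digits: "n > 0 \<Longrightarrow> inj_on (digits n r) {..<n ^ r}"
proof (induction r)
  case (Suc r)
  show ?case
  proof (rule inj_onI)
    fix k l assume *: "k \<in> {..<n ^ Suc r}" "l \<in> {..<n ^ Suc r}"
      "digits n (Suc r) k = digits n (Suc r) l"
    have "k div n < n ^ r" "l div n < n ^ r"
      using * by (auto simp: less_mult_imp_div_less mult.commute)
    hence "k div n = l div n"
      using * Suc by (auto dest: inj_onD)
    moreover have "k mod n = l mod n"
      using * by simp
    ultimately show "k = l"
      by (metis div_mult_mod_eq)
  qed
qed (simp add: inj_on_def)

lemma card_words: "card (words n r) = n ^ r"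
  using card_lists_length_eq[of "{..<n}" r] by (simp add: words_def)

text \<open>An injection between finite sets of the same size \<open>n ^ r\<close> is onto, so no
  inverse of \<open>digits\<close> has to be written down.\<close>

lemma bij_betw_digits:
  assumes "n > 0"
  shows "bij_betw (digits n r) {..<n ^ r} (words n r)"
proof -
  have "digits n r ` {..<n ^ r} = words n r"
    by (rule card_subset_eq)
      (use assms in \<open>auto simp: digits_in_words card_image inj_on_digits card_words\<close>)
  thus ?thesis
    using assms by (simp add: bij_betw_def inj_on_digits)
qed

text \<open>For words of equal length this is the entry of \<open>sigma_iter\<close> in row
  \<open>v\<close> and column \<open>w\<close>. The recursion consumes first letters because a
  scalar moving to the right meets the first letter of a monomial first. The second equation is
  meant for two empty words; on words of unequal length the value is a convention.\<close>

fun sigma_coeff :: "('a \<Rightarrow> 'a mat) \<Rightarrow> nat list \<Rightarrow> nat list \<Rightarrow> 'a \<Rightarrow> 'a" where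
  "sigma_coeff \<sigma> (i # v) (j # w) a = sigma_coeff \<sigma> v w (\<sigma> a $$ (i, j))"
| "sigma_coeff \<sigma> _ _ a = a"

text \<open>Bridges two recursions: \<open>sigma_coeff\<close> peels off first letters, whereas
  \<open>block_map\<close> refines an index by a new last letter.\<close>

lemma sigma_coeff_snoc:
  "length v = length w \<Longrightarrow>
    sigma_coeff \<sigma> (v @ [i]) (w @ [j]) a = \<sigma> (sigma_coeff \<sigma> v w a) $$ (i, j)"
  by (induction v w arbitrary: a rule: list_induct2) auto

lemma sigma_iter_carrier:
  assumes "is_mat_hom n \<sigma>"
  shows "sigma_iter n \<sigma> r a \<in> carrier_mat (n ^ r) (n ^ r)"
proof (induction r)
  case (Suc r)
  thus ?case
    using assms by (cases r) (auto simp: is_mat_hom_def block_map_def)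
qed auto

lemma sigma_iter_index:
  assumes "is_mat_hom n \<sigma>" "k < n ^ r" "l < n ^ r"
  shows "sigma_iter n \<sigma> r a $$ (k, l) = sigma_coeff \<sigma> (digits n r k) (digits n r l) a"
  using assms(2,3)
proof (induction r arbitrary: k l)
  case (Suc r)
  show ?case
  \<comment> \<open>The iteration starts at exponent 1 with \<open>\<sigma>\<close> itself, so
    \<open>block_map\<close> enters only when \<open>r\<close> is a successor.\<close>
  proof (cases r)
    case (Suc r')
    have "k div n < n ^ r" "l div n < n ^ r"
      using Suc.prems by (auto simp: less_mult_imp_div_less mult.commute)
    moreover have "sigma_iter n \<sigma> (Suc r) a = block_map n \<sigma> (sigma_iter n \<sigma> r a)"
      by (simp add: Suc)
    moreover have "dim_row (sigma_iter n \<sigma> r a) = n ^ r" "dim_col (sigma_iter n \<sigma> r a) = n ^ r"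
      using sigma_iter_carrier[OF assms(1), of r a] by auto
    ultimately show ?thesis
      using Suc.IH[of "k div n" "l div n"] Suc.prems
      by (simp add: block_map_def sigma_coeff_snoc mult.commute)
  qed (use Suc.prems in auto)
qed auto

text \<open>A nonzero matrix killed by \<open>sigma_iter n \<sigma> r a\<close> has a nonzero
  column, which is a killed vector \<open>b\<close>; conversely, a killed vector repeated in every
  column is a killed matrix. Coordinates are renamed from numbers to words.\<close>

lemma left_zero_divisor_sigma_iter_iff:
  fixes \<sigma> :: "'a::ring_1 \<Rightarrow> 'a mat"
  assumes "is_mat_hom n \<sigma>" "n > 0"
  shows "left_zero_divisor_mat (n ^ r) (sigma_iter n \<sigma> r a) \<longleftrightarrow>
    (\<exists>b. (\<exists>w\<in>words n r. b w \<noteq> 0) \<and>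
      (\<forall>v\<in>words n r. (\<Sum>w\<in>words n r. sigma_coeff \<sigma> v w a * b w) = 0))"
    (is "?L \<longleftrightarrow> ?R")
proof -
  let ?N = "n ^ r" and ?A = "sigma_iter n \<sigma> r a"
  have carrier: "?A \<in> carrier_mat ?N ?N"
    using assms(1) by (rule sigma_iter_carrier)
  note bij = bij_betw_digits[OF assms(2), of r]
  have image: "words n r = digits n r ` {..<?N}"
    using bij by (simp add: bij_betw_def)
  have entry: "(?A * B) $$ (k, j) =
      (\<Sum>w\<in>words n r. sigma_coeff \<sigma> (digits n r k) w a * c w)"
    if "B \<in> carrier_mat ?N ?N" "k < ?N" "j < ?N"
      "\<And>l. l < ?N \<Longrightarrow> B $$ (l, j) = c (digits n r l)" for B c k j
  proof -
    have "(?A * B) $$ (k, j) = (\<Sum>l<?N. ?A $$ (k, l) * B $$ (l, j))"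
      using that carrier by (auto simp: scalar_prod_def atLeast0LessThan)
    also have "\<dots> = (\<Sum>l<?N. sigma_coeff \<sigma> (digits n r k) (digits n r l) a * c (digits n r l))"
      using that assms by (intro sum.cong) (auto simp: sigma_iter_index)
    also have "\<dots> = (\<Sum>w\<in>words n r. sigma_coeff \<sigma> (digits n r k) w a * c w)"
      by (rule sum.reindex_bij_betw[OF bij])
    finally show ?thesis .
  qed
  show ?thesis
  proof
    assume ?L
    then obtain B where B: "B \<in> carrier_mat ?N ?N" "B \<noteq> 0\<^sub>m ?N ?N" "?A * B = 0\<^sub>m ?N ?N"
      by (auto simp: left_zero_divisor_mat_def)
    then obtain k j where kj: "k < ?N" "j < ?N" "B $$ (k, j) \<noteq> 0"
      by (metis carrier_matD eq_matI index_zero_mat)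
    define c where "c w = B $$ (inv_into {..<?N} (digits n r) w, j)" for w
    have c: "c (digits n r l) = B $$ (l, j)" if "l < ?N" for l
      using that assms(2) by (simp add: c_def inj_on_digits)
    have "(\<Sum>w\<in>words n r. sigma_coeff \<sigma> v w a * c w) = 0" if v: "v \<in> words n r" for v
    proof -
      obtain l where "l < ?N" "v = digits n r l"
        using v image by auto
      thus ?thesis
        using entry[of B l j c] B kj c by simp
    qed
    moreover have "digits n r k \<in> words n r" "c (digits n r k) \<noteq> 0"
      using kj c assms(2) by (auto simp: digits_in_words)
    ultimately show ?R
      by blast
  next
    assume ?R
    then obtain c w where c: "w \<in> words n r" "c w \<noteq> 0"
      "\<forall>v\<in>words n r. (\<Sum>w\<in>words n r. sigma_coeff \<sigma> v w a * c w) = 0"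
      by blast
    define B where "B = mat ?N ?N (\<lambda>(l, _). c (digits n r l))"
    obtain k where k: "k < ?N" "w = digits n r k"
      using c(1) image by auto
    have "B \<noteq> 0\<^sub>m ?N ?N"
    proof
      assume "B = 0\<^sub>m ?N ?N"
      hence "B $$ (k, k) = 0"
        using k by simp
      thus False
        using k c(2) by (simp add: B_def)
    qed
    moreover have "?A * B = 0\<^sub>m ?N ?N"
    proof (rule eq_matI)
      fix i j assume "i < dim_row (0\<^sub>m ?N ?N :: 'a mat)" "j < dim_col (0\<^sub>m ?N ?N :: 'a mat)"
      thus "(?A * B) $$ (i, j) = 0\<^sub>m ?N ?N $$ (i, j)"
        using entry[of B i j c] c(3) assms(2) by (simp add: B_def digits_in_words)
    qed (use carrier in \<open>auto simp: B_def\<close>)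
    ultimately show ?L
      by (auto simp: left_zero_divisor_mat_def B_def)
  qed
qed

text \<open>The condition also covers \<open>r = 0\<close>, where it says that \<open>R\<close> is a domain: if \<open>a b = 0\<close>
  then \<open>\<sigma> a \<sigma> b = 0\<close>, so the case \<open>r = 1\<close> forces \<open>a = 0\<close> or \<open>b = 0\<close>.\<close>
lemma megainjective_iff:
  fixes \<sigma> :: "'a::ring_1 \<Rightarrow> 'a mat"
  assumes "is_mat_hom n \<sigma>" "n > 0"
  shows "megainjective n \<sigma> \<longleftrightarrow>
    (\<forall>a r b. a \<noteq> 0 \<longrightarrow> (\<exists>w\<in>words n r. b w \<noteq> 0) \<longrightarrow>
      (\<exists>v\<in>words n r. (\<Sum>w\<in>words n r. sigma_coeff \<sigma> v w a * b w) \<noteq> 0))"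
    (is "?L \<longleftrightarrow> ?R")
proof
  assume mega: ?L
  have domain: "a * b \<noteq> 0" if "a \<noteq> 0" "b \<noteq> 0" for a b :: 'a
  proof
    assume ab: "a * b = 0"
    have "\<sigma> b \<in> carrier_mat n n"
      using assms(1) by (simp add: is_mat_hom_def)
    have "\<sigma> 0 + \<sigma> 0 = \<sigma> 0"
      using assms(1) unfolding is_mat_hom_def by (metis add_0)
    have "\<sigma> 0 \<in> carrier_mat n n"
      using assms(1) by (simp add: is_mat_hom_def)
    \<comment> \<open>The cancellation in \<open>\<sigma> 0 + \<sigma> 0 = \<sigma> 0\<close> takes
      place in \<open>R\<close>, one entry at a time.\<close>
    have "\<sigma> 0 = 0\<^sub>m n n"
    proof (rule eq_matI)
      fix i j assume "i < dim_row (0\<^sub>m n n :: 'a mat)" "j < dim_col (0\<^sub>m n n :: 'a mat)"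
      moreover from this have "(\<sigma> 0 + \<sigma> 0) $$ (i, j) = \<sigma> 0 $$ (i, j) + \<sigma> 0 $$ (i, j)"
        using \<open>\<sigma> 0 \<in> carrier_mat n n\<close> by simp
      ultimately show "\<sigma> 0 $$ (i, j) = 0\<^sub>m n n $$ (i, j)"
        using \<open>\<sigma> 0 + \<sigma> 0 = \<sigma> 0\<close> by simp
    qed (use \<open>\<sigma> 0 \<in> carrier_mat n n\<close> in auto)
    hence "\<sigma> a * \<sigma> b = 0\<^sub>m n n"
      using assms(1) ab by (metis is_mat_hom_def)
    \<comment> \<open>Both halves of megainjectivity at exponent 1: nonvanishing for
      \<open>b\<close> makes \<open>\<sigma> b\<close> an admissible witness that
      \<open>\<sigma> a\<close> is a left zero divisor.\<close>
    moreover have "\<sigma> b \<noteq> 0\<^sub>m n n" "\<not> left_zero_divisor_mat n (\<sigma> a)"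
      using mega that unfolding megainjective_def
      by (metis One_nat_def order_refl power_one_right sigma_iter.simps(2))+
    ultimately show False
      using \<open>\<sigma> b \<in> carrier_mat n n\<close> by (auto simp: left_zero_divisor_mat_def)
  qed
  show ?R
  proof (intro allI impI)
    fix a :: 'a and r and b :: "nat list \<Rightarrow> 'a"
    assume a: "a \<noteq> 0" and b: "\<exists>w\<in>words n r. b w \<noteq> 0"
    show "\<exists>v\<in>words n r. (\<Sum>w\<in>words n r. sigma_coeff \<sigma> v w a * b w) \<noteq> 0"
    proof (cases r)
      case 0
      thus ?thesis
        using a b domain by (simp add: words_0)
    next
      case (Suc r')
      hence "r \<ge> 1"
        by simp
      hence "\<not> left_zero_divisor_mat (n ^ r) (sigma_iter n \<sigma> r a)"
        using mega a unfolding megainjective_def by blast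
      thus ?thesis
        using b left_zero_divisor_sigma_iter_iff[OF assms] by blast
    qed
  qed
next
  assume R: ?R
  have nzd: "\<not> left_zero_divisor_mat (n ^ r) (sigma_iter n \<sigma> r a)" if "a \<noteq> 0" for a r
    using R that left_zero_divisor_sigma_iter_iff[OF assms] by blast
  \<comment> \<open>The zero matrix kills the identity, which is nonzero as
    \<open>n ^ r > 0\<close>. This yields the nonvanishing half from \<open>nzd\<close>.\<close>
  have "left_zero_divisor_mat (n ^ r) (0\<^sub>m (n ^ r) (n ^ r) :: 'a mat)" for r
  proof -
    have "(1\<^sub>m (n ^ r) :: 'a mat) $$ (0, 0) \<noteq> 0\<^sub>m (n ^ r) (n ^ r) $$ (0, 0)"
      using assms(2) by simp
    hence "(1\<^sub>m (n ^ r) :: 'a mat) \<noteq> 0\<^sub>m (n ^ r) (n ^ r)"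
      by metis
    thus ?thesis
      unfolding left_zero_divisor_mat_def by (intro bexI[of _ "1\<^sub>m (n ^ r)"]) auto
  qed
  thus ?L
    unfolding megainjective_def using nzd by metis
qed

section \<open>Monomials and right linear combinations\<close>

locale free_skew_extension =
  fixes n :: nat and \<sigma> :: "'a::ring_1 \<Rightarrow> 'a mat" and \<delta> :: "'a \<Rightarrow> 'a vec"
    and \<iota> :: "'a \<Rightarrow> 's::ring_1" and x :: "nat \<Rightarrow> 's"
  assumes extension: "is_free_skew_extension n \<sigma> \<delta> \<iota> x"
begin

sublocale \<iota>: inj_ring_hom \<iota>
  using extension by (simp add: is_free_skew_extension_def)

lemma commutation:
  "j < n \<Longrightarrow> \<iota> r * x j = (\<Sum>i<n. x i * \<iota> (\<sigma> r $$ (i, j))) + \<iota> (\<delta> r $ j)"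
  using extension by (simp add: is_free_skew_extension_def)

definition monomial :: "nat list \<Rightarrow> 's" where
  "monomial w = prod_list (map x w)"

lemma monomial_simps [simp]:
  "monomial [] = 1" "monomial (i # w) = x i * monomial w"
  "monomial (v @ w) = monomial v * monomial w"
  by (auto simp: monomial_def)

text \<open>A composite of two injections: \<open>x\<close> on letters, and evaluation of words over
  the generators, which is injective by freeness. Thus coefficients may be attached to words instead
  of elements of \<open>S\<close>.\<close>

lemma inj_on_monomial: "inj_on monomial (lists {..<n})"
proof -
  have "inj_on (map x) (lists {..<n})"
    using extension by (intro inj_on_mapI) (auto simp: is_free_skew_extension_def inj_on_def)
  moreover have "map x ` lists {..<n} = lists (x ` {..<n})"
    by (simp add: lists_image)
  ultimately have "inj_on (prod_list \<circ> map x) (lists {..<n})"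
    using extension by (intro comp_inj_on) (auto simp: is_free_skew_extension_def free_on_def)
  thus ?thesis
    by (simp add: monomial_def[abs_def] comp_def)
qed

lemma generated_monoid_eq: "generated_monoid (x ` {..<n}) = monomial ` lists {..<n}"
  by (simp add: generated_monoid_def lists_image image_image monomial_def)

lemma monomials_upto_eq: "monomials_upto (x ` {..<n}) m = monomial ` words_below n (Suc m)"
proof -
  have "monomials_upto (x ` {..<n}) m = prod_list ` {w \<in> lists (x ` {..<n}). length w \<le> m}"
    by (auto simp: monomials_upto_def)
  also have "{w \<in> lists (x ` {..<n}). length w \<le> m} = map x ` words_below n (Suc m)"
  proof -
    have "words_below n (Suc m) = {w \<in> lists {..<n}. length w \<le> m}"
      by (auto simp: words_below_def)
    thus ?thesis
      unfolding lists_image by force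
  qed
  finally show ?thesis
    by (simp add: image_image monomial_def)
qed

text \<open>Indexing by words rather than by monomials makes length, first letter and prefixes of
  the index available.\<close>

definition combination :: "nat list set \<Rightarrow> (nat list \<Rightarrow> 'a) \<Rightarrow> 's" where
  "combination A c = (\<Sum>w\<in>A. monomial w * \<iota> (c w))"

text \<open>The bound is strict, so that \<open>span_below (Suc m)\<close> is \<open>S\<^sub>m\<close> and \<open>span_below 0 = {0}\<close>.\<close>
definition span_below :: "nat \<Rightarrow> 's set" where
  "span_below m = range (combination (words_below n m))"

text \<open>Coefficients given on a subset of the monomials are padded with 0; injectivity of
  \<open>monomial\<close> carries them to words and back.\<close>

lemma right_span_monomial:
  assumes "finite A" "A \<subseteq> lists {..<n}"
  shows "right_span \<iota> (monomial ` A) = range (combination A)"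
proof (intro equalityI subsetI)
  fix f assume "f \<in> right_span \<iota> (monomial ` A)"
  then obtain B c where B: "finite B" "B \<subseteq> monomial ` A" "f = (\<Sum>b\<in>B. b * \<iota> (c b))"
    by (auto simp: right_span_def)
  have "f = (\<Sum>b\<in>monomial ` A. b * \<iota> (if b \<in> B then c b else 0))"
    unfolding B(3) using assms(1) B(2) by (intro sum.mono_neutral_cong_left) auto
  also have "\<dots> = combination A (\<lambda>w. if monomial w \<in> B then c (monomial w) else 0)"
    unfolding combination_def
    using inj_on_subset[OF inj_on_monomial assms(2)] by (simp add: sum.reindex)
  finally show "f \<in> range (combination A)"
    by blast
next
  fix f assume "f \<in> range (combination A)"
  then obtain c where "f = combination A c"
    by blast
  also have "\<dots> = (\<Sum>b\<in>monomial ` A. b * \<iota> (c (inv_into A monomial b)))"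
    unfolding combination_def
    using inj_on_subset[OF inj_on_monomial assms(2)] by (simp add: sum.reindex)
  finally show "f \<in> right_span \<iota> (monomial ` A)"
    unfolding right_span_def using assms(1)
    by (intro CollectI exI[of _ "monomial ` A"] exI[of _ "\<lambda>b. c (inv_into A monomial b)"]) simp
qed

lemma words_below_subset: "words_below n m \<subseteq> lists {..<n}"
  by (auto simp: words_below_def)

lemma skew_filtration_Fin: "skew_filtration \<iota> (x ` {..<n}) (Fin m) = span_below (Suc m)"
  by (simp add: monomials_upto_eq right_span_monomial words_below_subset span_below_def)

lemma combination_eq_0_iff:
  assumes "finite A" "A \<subseteq> lists {..<n}"
  shows "combination A c = 0 \<longleftrightarrow> (\<forall>w\<in>A. c w = 0)"
proof
  assume "combination A c = 0"
  moreover have "combination A c = (\<Sum>b\<in>monomial ` A. b * \<iota> (c (inv_into A monomial b)))"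
    unfolding combination_def
    using inj_on_subset[OF inj_on_monomial assms(2)] by (simp add: sum.reindex)
  moreover have "right_independent \<iota> (monomial ` lists {..<n})"
    using extension by (simp add: is_free_skew_extension_def is_right_basis_def generated_monoid_eq)
  ultimately have "\<forall>b\<in>monomial ` A. c (inv_into A monomial b) = 0"
    using assms unfolding right_independent_def
    by (elim allE[of _ "monomial ` A"] allE[of _ "\<lambda>b. c (inv_into A monomial b)"])
      (simp add: image_mono)
  thus "\<forall>w\<in>A. c w = 0"
    using inj_on_subset[OF inj_on_monomial assms(2)] by simp
qed (simp add: combination_def)

lemma combination_diff: "combination A c - combination A d = combination A (\<lambda>w. c w - d w)"
  by (simp add: combination_def sum_subtractf right_diff_distrib \<iota>.hom_minus)

lemma combination_mult_right: "combination A c * \<iota> a = combination A (\<lambda>w. c w * a)"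
  by (simp add: combination_def sum_distrib_right mult.assoc \<iota>.hom_mult)

section \<open>The filtration by length and leading parts\<close>

lemma combination_words_below_Suc:
  "combination (words_below n (Suc m)) c =
    combination (words_below n m) c + combination (words n m) c"
  unfolding combination_def words_below_Suc
  by (rule sum.union_disjoint) (auto simp: words_below_disjoint)

lemma span_below_0 [simp]: "span_below 0 = {0}"
  by (auto simp: span_below_def combination_def)

lemma span_below_diff: "f \<in> span_below m \<Longrightarrow> g \<in> span_below m \<Longrightarrow> f - g \<in> span_below m"
  by (auto simp: span_below_def combination_diff)

lemma zero_in_span_below [simp]: "0 \<in> span_below m"
  using span_below_diff[of "combination (words_below n m) undefined" m]
  by (metis cancel_comm_monoid_add_class.diff_cancel rangeI span_below_def)

lemma span_below_add:
  assumes "f \<in> span_below m" "g \<in> span_below m"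
  shows "f + g \<in> span_below m"
  using span_below_diff[OF assms(1) span_below_diff[OF zero_in_span_below assms(2)]] by simp

lemma span_below_add_iff: "f \<in> span_below m \<Longrightarrow> f + g \<in> span_below m \<longleftrightarrow> g \<in> span_below m"
  using span_below_add span_below_diff by (metis add_diff_cancel_left')

lemma span_below_sum: "(\<And>i. i \<in> I \<Longrightarrow> f i \<in> span_below m) \<Longrightarrow> sum f I \<in> span_below m"
  by (induction I rule: infinite_finite_induct) (auto intro: span_below_add)

lemma span_below_mult_right: "f \<in> span_below m \<Longrightarrow> f * \<iota> a \<in> span_below m"
  by (auto simp: span_below_def combination_mult_right)

lemma monomial_in_span_below:
  assumes "w \<in> words_below n m"
  shows "monomial w * \<iota> a \<in> span_below m"
proof -
  have "combination (words_below n m) (\<lambda>v. if v = w then a else 0) =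
      (\<Sum>v\<in>words_below n m. if v = w then monomial w * \<iota> a else 0)"
    unfolding combination_def by (intro sum.cong) auto
  also have "\<dots> = monomial w * \<iota> a"
    using assms by simp
  finally show ?thesis
    unfolding span_below_def by (metis rangeI)
qed

lemma combination_in_span_below: "A \<subseteq> words_below n m \<Longrightarrow> combination A c \<in> span_below m"
  unfolding combination_def by (intro span_below_sum monomial_in_span_below) auto

lemma span_below_mono: "k \<le> m \<Longrightarrow> span_below k \<subseteq> span_below m"
proof -
  assume "k \<le> m"
  hence "words_below n k \<subseteq> words_below n m"
    by (auto simp: words_below_def)
  thus ?thesis
    unfolding span_below_def[of k] by (auto intro: combination_in_span_below)
qed

lemma span_below_exhaust: "\<exists>m. f \<in> span_below m"
proof -
  have "right_span \<iota> (monomial ` lists {..<n}) = UNIV"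
    using extension by (simp add: is_free_skew_extension_def is_right_basis_def generated_monoid_eq)
  hence "f \<in> right_span \<iota> (monomial ` lists {..<n})"
    by simp
  then obtain A c where A: "finite A" "A \<subseteq> monomial ` lists {..<n}" "f = (\<Sum>b\<in>A. b * \<iota> (c b))"
    unfolding right_span_def mem_Collect_eq by blast
  then obtain B where B: "B \<subseteq> lists {..<n}" "finite B" "A = monomial ` B"
    by (meson finite_subset_image)
  \<comment> \<open>The \<open>Suc\<close> makes the length bound strict. If \<open>B\<close> is
    empty, the value of \<open>Max\<close> is arbitrary, but then nothing has to be bounded.\<close>
  define m where "m = Suc (Max (length ` B))"
  have "B \<subseteq> words_below n m"
    using B by (auto simp: words_below_def m_def less_Suc_eq_le)
  hence "b * \<iota> (c b) \<in> span_below m" if "b \<in> A" for b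
    using that B by (auto intro: monomial_in_span_below)
  thus ?thesis
    unfolding A(3) by (blast intro: span_below_sum)
qed

text \<open>Independence of the monomials modulo shorter ones: it makes nonzero leading coefficients
  detectable by membership alone.\<close>

lemma combination_words_in_span_below_iff:
  "combination (words n m) c \<in> span_below m \<longleftrightarrow> (\<forall>w\<in>words n m. c w = 0)"
proof
  assume "combination (words n m) c \<in> span_below m"
  then obtain d where d: "combination (words n m) c = combination (words_below n m) d"
    by (auto simp: span_below_def)
  \<comment> \<open>The difference of the two sides as one family: \<open>d\<close> on shorter
    words, \<open>- c\<close> on words of length \<open>m\<close>. Its combination is 0, so
    independence applies.\<close>
  define e where "e w = (if w \<in> words n m then - c w else d w)" for w
  have "combination (words_below n m) e = combination (words_below n m) d"
    unfolding combination_def using words_below_disjoint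
    by (intro sum.cong) (auto simp: e_def)
  moreover have "combination (words n m) e = - combination (words n m) c"
    by (simp add: combination_def e_def \<iota>.hom_uminus sum_negf)
  ultimately have "combination (words_below n (Suc m)) e = 0"
    using d by (simp add: combination_words_below_Suc)
  hence e: "\<forall>w\<in>words_below n (Suc m). e w = 0"
    by (simp add: combination_eq_0_iff words_below_subset)
  show "\<forall>w\<in>words n m. c w = 0"
  proof
    fix w assume "w \<in> words n m"
    moreover from this have "e w = 0"
      using e by (simp add: words_below_Suc)
    ultimately show "c w = 0"
      by (simp add: e_def)
  qed
qed (simp add: combination_def)

lemma leading_part:
  assumes "f \<in> span_below (Suc m)"
  obtains c where "f - combination (words n m) c \<in> span_below m"
proof -
  obtain c where "f = combination (words_below n (Suc m)) c"
    using assms by (auto simp: span_below_def)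
  hence "f - combination (words n m) c = combination (words_below n m) c"
    by (simp add: combination_words_below_Suc)
  thus ?thesis
    by (intro that[of c]) (simp add: span_below_def)
qed

section \<open>Products and the filtration\<close>

lemma monomial_mult_span_below:
  assumes "f \<in> span_below m" "u \<in> words n p"
  shows "monomial u * f \<in> span_below (p + m)"
proof -
  obtain c where "f = combination (words_below n m) c"
    using assms by (auto simp: span_below_def)
  hence "monomial u * f = (\<Sum>w\<in>words_below n m. monomial (u @ w) * \<iota> (c w))"
    by (simp add: combination_def sum_distrib_left mult.assoc)
  also have "\<dots> \<in> span_below (p + m)"
    using assms(2)
    by (intro span_below_sum monomial_in_span_below) (auto simp: words_def words_below_def)
  finally show ?thesis .
qed

text \<open>Induction on \<open>w\<close>: moving \<open>a\<close> past \<open>x j\<close> leaves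
  the scalars \<open>\<sigma> a $$ (i, j)\<close> behind each \<open>x i\<close>, and these are
  moved past the remaining letters by the induction hypothesis.\<close>

lemma scalar_mult_monomial:
  assumes "w \<in> words n r"
  shows "\<iota> a * monomial w - combination (words n r) (\<lambda>v. sigma_coeff \<sigma> v w a) \<in> span_below r"
  using assms
proof (induction w arbitrary: a r)
  case Nil
  hence "r = 0"
    by (simp add: words_def)
  thus ?case
    by (simp add: words_0 combination_def)
next
  case (Cons j w)
  then obtain q where r: "r = Suc q" and w: "w \<in> words n q" and j: "j < n"
    by (auto simp: words_def)
  let ?s = "\<lambda>i. \<sigma> a $$ (i, j)"
  have "\<iota> a * monomial (j # w) = (\<iota> a * x j) * monomial w"
    by (simp add: mult.assoc)
  also have "\<dots> = (\<Sum>i<n. x i * (\<iota> (?s i) * monomial w)) + \<iota> (\<delta> a $ j) * monomial w"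
    by (simp add: commutation[OF j] distrib_right sum_distrib_right mult.assoc)
  \<comment> \<open>Splitting the words of length \<open>r\<close> by their first letter matches the
    recursion of \<open>sigma_coeff\<close>.\<close>
  finally have "\<iota> a * monomial (j # w) - combination (words n r) (\<lambda>v. sigma_coeff \<sigma> v (j # w) a) =
      (\<Sum>i<n. monomial [i] *
        (\<iota> (?s i) * monomial w - combination (words n q) (\<lambda>v. sigma_coeff \<sigma> v w (?s i)))) +
      \<iota> (\<delta> a $ j) * monomial w"
    by (simp add: r combination_def sum_words_Suc right_diff_distrib sum_subtractf
        sum_distrib_left mult.assoc)
  moreover have "monomial [i] *
      (\<iota> (?s i) * monomial w - combination (words n q) (\<lambda>v. sigma_coeff \<sigma> v w (?s i)))
      \<in> span_below r" if "i < n" for i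
    using monomial_mult_span_below[OF Cons.IH[OF w], of "[i]" 1] that by (simp add: r words_def)
  \<comment> \<open>The derivation term has lost a letter, so by the induction hypothesis it only
    involves words of length at most \<open>q\<close>, below \<open>r\<close>.\<close>
  moreover have "\<iota> (\<delta> a $ j) * monomial w \<in> span_below r"
  proof -
    have "\<iota> (\<delta> a $ j) * monomial w -
        combination (words n q) (\<lambda>v. sigma_coeff \<sigma> v w (\<delta> a $ j)) \<in> span_below r"
      using Cons.IH[OF w] span_below_mono[of q r] r by auto
    moreover have "combination (words n q) (\<lambda>v. sigma_coeff \<sigma> v w (\<delta> a $ j)) \<in> span_below r"
      by (intro combination_in_span_below) (auto simp: r words_below_Suc)
    ultimately show ?thesis
      using span_below_add by fastforce
  qed
  ultimately show ?case
    by (auto intro!: span_below_add span_below_sum)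
qed

text \<open>The bounds are strict: lengths at most \<open>p - 1\<close> and \<open>q - 1\<close> add
  up to less than \<open>p + q - 1\<close>. If \<open>p\<close> or \<open>q\<close> is 0, truncated
  subtraction does no harm, since the product is 0.\<close>

lemma span_below_mult:
  assumes "f \<in> span_below p" "g \<in> span_below q"
  shows "f * g \<in> span_below (p + q - 1)"
proof -
  obtain c d where f: "f = combination (words_below n p) c" and g: "g = combination (words_below n q) d"
    using assms by (auto simp: span_below_def)
  have "f * g = (\<Sum>u\<in>words_below n p. \<Sum>w\<in>words_below n q.
      monomial u * (\<iota> (c u) * monomial w) * \<iota> (d w))"
    by (simp add: f g combination_def sum_product mult.assoc)
  also have "\<dots> \<in> span_below (p + q - 1)"
  proof (intro span_below_sum span_below_mult_right)
    fix u w assume u: "u \<in> words_below n p" and w: "w \<in> words_below n q"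
    let ?l = "length w"
    have w': "w \<in> words n ?l"
      using w by (simp add: words_def words_below_def)
    have "\<iota> (c u) * monomial w - combination (words n ?l) (\<lambda>v. sigma_coeff \<sigma> v w (c u))
        \<in> span_below (Suc ?l)"
      using scalar_mult_monomial[OF w'] span_below_mono[of ?l "Suc ?l"] by auto
    moreover have "combination (words n ?l) (\<lambda>v. sigma_coeff \<sigma> v w (c u)) \<in> span_below (Suc ?l)"
      by (intro combination_in_span_below) (auto simp: words_below_Suc)
    ultimately have "\<iota> (c u) * monomial w \<in> span_below (Suc ?l)"
      using span_below_add by fastforce
    hence "monomial u * (\<iota> (c u) * monomial w) \<in> span_below (length u + Suc ?l)"
      using u by (intro monomial_mult_span_below) (auto simp: words_def words_below_def)
    moreover have "length u + Suc ?l \<le> p + q - 1"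
      using u w by (auto simp: words_below_def)
    ultimately show "monomial u * (\<iota> (c u) * monomial w) \<in> span_below (p + q - 1)"
      using span_below_mono by blast
  qed
  finally show ?thesis .
qed

text \<open>With leading parts \<open>F\<close> and \<open>G\<close>, the splitting
  \<open>f * g = (f - F) * g + F * (g - G) + F * G\<close> has its first two terms in
  \<open>span_below (p + q)\<close>, so only the product of the leading parts matters.\<close>

lemma mult_in_span_below_iff:
  assumes f: "f - combination (words n p) c \<in> span_below p"
    and g: "g - combination (words n q) d \<in> span_below q"
  shows "f * g \<in> span_below (p + q) \<longleftrightarrow>
    (\<forall>u\<in>words n p. \<forall>v\<in>words n q. (\<Sum>w\<in>words n q. sigma_coeff \<sigma> v w (c u) * d w) = 0)"
proof -
  let ?F = "combination (words n p) c" and ?G = "combination (words n q) d"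
  \<comment> \<open>The coefficients of \<open>F * G\<close> in degree \<open>p + q\<close>: a word
    is cut after \<open>p\<close> letters into a word from \<open>F\<close> and a row index for
    \<open>\<sigma>\<close>.\<close>
  define e where "e z = (\<Sum>w\<in>words n q. sigma_coeff \<sigma> (drop p z) w (c (take p z)) * d w)" for z
  have e: "e (u @ v) = (\<Sum>w\<in>words n q. sigma_coeff \<sigma> v w (c u) * d w)" if "u \<in> words n p" for u v
    using that by (simp add: e_def words_def)
  let ?E = "combination (words n (p + q)) e"
  have F: "?F \<in> span_below (Suc p)" and G: "?G \<in> span_below (Suc q)"
    by (auto intro: combination_in_span_below simp: words_below_Suc)
  have "g \<in> span_below (Suc q)"
    using span_below_add[of "g - ?G" "Suc q" ?G] g G span_below_mono[of q "Suc q"] by auto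
  hence "(f - ?F) * g \<in> span_below (p + q)"
    using span_below_mult[OF f, of g "Suc q"] by simp
  moreover have "?F * (g - ?G) \<in> span_below (p + q)"
    using span_below_mult[OF F g] by simp
  moreover have "?F * ?G - ?E \<in> span_below (p + q)"
  proof -
    let ?D = "\<lambda>u w. \<iota> (c u) * monomial w - combination (words n q) (\<lambda>v. sigma_coeff \<sigma> v w (c u))"
    have "?E = (\<Sum>u\<in>words n p. \<Sum>v\<in>words n q. \<Sum>w\<in>words n q.
        monomial u * (monomial v * (\<iota> (sigma_coeff \<sigma> v w (c u)) * \<iota> (d w))))"
      unfolding combination_def sum_words_append
      by (intro sum.cong) (simp_all add: e \<iota>.hom_sum \<iota>.hom_mult sum_distrib_left mult.assoc)
    \<comment> \<open>Swapping the sums over \<open>v\<close> and \<open>w\<close> gathers, for each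
      \<open>u\<close> and \<open>w\<close>, the leading part of
      \<open>\<iota> (c u) * monomial w\<close>.\<close>
    also have "\<dots> = (\<Sum>u\<in>words n p. \<Sum>w\<in>words n q.
        monomial u * (combination (words n q) (\<lambda>v. sigma_coeff \<sigma> v w (c u)) * \<iota> (d w)))"
      by (subst sum.swap[of _ "words n q" "words n q"])
        (simp add: combination_def sum_distrib_left sum_distrib_right mult.assoc)
    finally have "?F * ?G - ?E =
        (\<Sum>u\<in>words n p. \<Sum>w\<in>words n q. monomial u * (?D u w * \<iota> (d w)))"
      by (simp add: combination_def[of "words n p"] combination_def[of "words n q" d] sum_product
          sum_subtractf left_diff_distrib right_diff_distrib mult.assoc)
    also have "\<dots> \<in> span_below (p + q)"
      by (intro span_below_sum monomial_mult_span_below span_below_mult_right scalar_mult_monomial)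
    finally show ?thesis .
  qed
  ultimately have "((f - ?F) * g + ?F * (g - ?G)) + (?F * ?G - ?E) \<in> span_below (p + q)"
    by (intro span_below_add)
  hence "f * g - ?E \<in> span_below (p + q)"
    by (simp add: algebra_simps)
  hence "f * g \<in> span_below (p + q) \<longleftrightarrow> ?E \<in> span_below (p + q)"
    using span_below_add_iff[of "f * g - ?E" "p + q" ?E] by simp
  also have "\<dots> \<longleftrightarrow> (\<forall>u\<in>words n p. \<forall>v\<in>words n q. e (u @ v) = 0)"
  proof -
    have "(\<forall>z\<in>words n (p + q). e z = 0) \<longleftrightarrow> (\<forall>u\<in>words n p. \<forall>v\<in>words n q. e (u @ v) = 0)"
    proof (intro iffI ballI)
      fix z assume "\<forall>u\<in>words n p. \<forall>v\<in>words n q. e (u @ v) = 0" "z \<in> words n (p + q)"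
      moreover from this have "take p z \<in> words n p" "drop p z \<in> words n q"
        by (auto simp: words_def dest: in_set_takeD in_set_dropD)
      ultimately show "e z = 0"
        by (metis append_take_drop_id)
    qed (auto simp: words_def)
    thus ?thesis
      by (simp add: combination_words_in_span_below_iff)
  qed
  finally show ?thesis
    by (simp add: e)
qed

section \<open>The degree and its additivity\<close>

abbreviation degree :: "'s \<Rightarrow> nat extended" where
  "degree \<equiv> skew_degree \<iota> (x ` {..<n})"

abbreviation filtration :: "nat extended \<Rightarrow> 's set" where
  "filtration \<equiv> skew_filtration \<iota> (x ` {..<n})"

declare skew_filtration.simps(1) [simp del] skew_filtration_Fin [simp]

lemma degree_0: "degree 0 = Minf"
  unfolding skew_degree_def by (rule Least_equality) auto

text \<open>Because of the strict bounds, \<open>span_below (Suc m)\<close> is the step of the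
  filtration at \<open>m\<close>. For \<open>m = 0\<close> the second assumption says that
  \<open>f\<close> is nonzero.\<close>

lemma degree_eqI:
  assumes "f \<in> span_below (Suc m)" "f \<notin> span_below m"
  shows "degree f = Fin m"
  unfolding skew_degree_def
proof (rule Least_equality)
  fix d assume d: "f \<in> filtration d"
  show "Fin m \<le> d"
  proof (cases d)
    case (Fin k)
    thus ?thesis
      using d assms(2) span_below_mono[of "Suc k" m] by (auto simp: not_less_eq_eq[symmetric])
  next
    case Minf
    thus ?thesis
      using d assms(2) by simp
  qed auto
qed (use assms in simp)

text \<open>For nonzero \<open>f\<close> the least \<open>k\<close> with
  \<open>f \<in> span_below k\<close> is positive, as \<open>span_below 0\<close> is zero; its
  predecessor is the degree. In particular \<open>Pinf\<close> never occurs.\<close>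

lemma degree_cases:
  obtains "f = 0" "degree f = Minf"
  | m where "f \<noteq> 0" "degree f = Fin m" "f \<in> span_below (Suc m)" "f \<notin> span_below m"
proof (cases "f = 0")
  case True
  thus ?thesis
    using that degree_0 by blast
next
  case False
  define k where "k = (LEAST k. f \<in> span_below k)"
  have k: "f \<in> span_below k"
    unfolding k_def using span_below_exhaust by (rule LeastI_ex)
  then obtain m where m: "k = Suc m"
    using False by (cases k) auto
  have "f \<notin> span_below m"
    using not_less_Least[of m "\<lambda>k. f \<in> span_below k"] m k_def by simp
  thus ?thesis
    using that(2) degree_eqI False k m by blast
qed

text \<open>Turns the inequalities of a pseudo-valuation into closure properties of the
  filtration.\<close>

lemma degree_le_iff: "degree f \<le> d \<longleftrightarrow> f \<in> filtration d"
proof (cases f rule: degree_cases)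
  case 1
  thus ?thesis
    by (cases d) auto
next
  case (2 m)
  show ?thesis
  proof (cases d)
    case (Fin k)
    show ?thesis
    proof (cases "m \<le> k")
      case True
      thus ?thesis
        using 2 Fin span_below_mono[of "Suc m" "Suc k"] by auto
    next
      case False
      thus ?thesis
        using 2 Fin span_below_mono[of "Suc k" m] by auto
    qed
  qed (use 2 in auto)
qed

lemma filtration_diff: "f \<in> filtration d \<Longrightarrow> g \<in> filtration d \<Longrightarrow> f - g \<in> filtration d"
  by (cases d) (auto intro: span_below_diff)

lemma pseudo_valuation_degree: "pseudo_valuation degree"
  unfolding pseudo_valuation_def
proof (intro conjI allI impI)
  show "degree f \<noteq> Pinf" for f
    by (cases f rule: degree_cases) auto
  show "degree f \<ge> 0" if "f \<noteq> 0" for f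
    using that by (cases f rule: degree_cases) (auto simp: zero_extended_def)
  show "degree 0 = Minf"
    by (rule degree_0)
  show "degree (f - g) \<le> max (degree f) (degree g)" for f g
    using filtration_diff[of f "max (degree f) (degree g)" g]
    by (simp flip: degree_le_iff)
  show "degree (f * g) \<le> degree f + degree g" for f g
  proof (cases f rule: degree_cases)
    case f: (2 p)
    show ?thesis
    proof (cases g rule: degree_cases)
      case (2 q)
      \<comment> \<open>The bound \<open>Suc p + Suc q - 1\<close> is \<open>Suc (p + q)\<close>,
        that is, degree at most \<open>p + q\<close>.\<close>
      thus ?thesis
        using f span_below_mult[of f "Suc p" g "Suc q"] by (simp add: degree_le_iff)
    qed (simp add: degree_0)
  qed (simp add: degree_0)
  have "1 \<in> span_below (Suc 0)"
    using monomial_in_span_below[of "[]" "Suc 0" 1] by (simp add: words_below_def)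
  thus "degree 1 = 0"
    using degree_eqI[of 1 0] by (simp add: zero_extended_def)
qed

text \<open>Forwards, additivity is tested on a scalar times a homogeneous element; backwards, a
  single nonzero leading coefficient of \<open>f\<close> suffices to produce a nonzero coefficient
  in degree \<open>p + q\<close>.\<close>

lemma degree_function_iff:
  "degree_function degree \<longleftrightarrow>
    (\<forall>a r b. a \<noteq> 0 \<longrightarrow> (\<exists>w\<in>words n r. b w \<noteq> 0) \<longrightarrow>
      (\<exists>v\<in>words n r. (\<Sum>w\<in>words n r. sigma_coeff \<sigma> v w a * b w) \<noteq> 0))"
    (is "?L \<longleftrightarrow> ?R")
proof
  assume L: ?L
  show ?R
  proof (intro allI impI)
    fix a :: 'a and r and b :: "nat list \<Rightarrow> 'a"
    assume a: "a \<noteq> 0" and b: "\<exists>w\<in>words n r. b w \<noteq> 0"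
    let ?g = "combination (words n r) b"
    \<comment> \<open>A scalar is its own leading part in degree 0, so
      \<open>mult_in_span_below_iff\<close> applies with \<open>p = 0\<close> and the empty word as
      the only \<open>u\<close>.\<close>
    have "combination (words n 0) (\<lambda>_. a) = \<iota> a"
      by (simp add: combination_def words_0)
    moreover from this have "\<iota> a \<in> span_below (Suc 0)"
      using combination_in_span_below[of "words n 0" "Suc 0" "\<lambda>_. a"] by (simp add: words_below_Suc)
    ultimately have "degree (\<iota> a) = Fin 0" "\<iota> a - combination (words n 0) (\<lambda>_. a) \<in> span_below 0"
      using a by (auto intro: degree_eqI)
    moreover have "degree ?g = Fin r"
      using b by (intro degree_eqI)
        (auto simp: combination_words_in_span_below_iff words_below_Suc intro: combination_in_span_below)
    ultimately have "degree (\<iota> a * ?g) = Fin r"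
      using L by (simp add: degree_function_def)
    have "\<iota> a * ?g \<notin> span_below r"
    proof
      assume *: "\<iota> a * ?g \<in> span_below r"
      show False
      proof (cases "\<iota> a * ?g" rule: degree_cases)
        case 1
        thus ?thesis
          using \<open>degree (\<iota> a * ?g) = Fin r\<close> by simp
      next
        case (2 m)
        thus ?thesis
          using \<open>degree (\<iota> a * ?g) = Fin r\<close> * by simp
      qed
    qed
    thus "\<exists>v\<in>words n r. (\<Sum>w\<in>words n r. sigma_coeff \<sigma> v w a * b w) \<noteq> 0"
      using mult_in_span_below_iff[of "\<iota> a" 0 "\<lambda>_. a" ?g r b]
        \<open>\<iota> a - combination (words n 0) (\<lambda>_. a) \<in> span_below 0\<close>
      by (auto simp: words_0)
  qed
next
  assume R: ?R
  have "degree (f * g) = degree f + degree g" for f g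
  proof (cases f rule: degree_cases)
    case 1
    thus ?thesis
      by (cases g rule: degree_cases) (auto simp: degree_0)
  next
    case f: (2 p)
    show ?thesis
    proof (cases g rule: degree_cases)
      case 1
      thus ?thesis
        using f by (simp add: degree_0)
    next
      case g: (2 q)
      obtain c d where cd: "f - combination (words n p) c \<in> span_below p"
        "g - combination (words n q) d \<in> span_below q"
        using f g leading_part by metis
      \<comment> \<open>A vanishing leading part would put \<open>f\<close> into
        \<open>span_below p\<close>, against the choice of \<open>p\<close>; likewise for
        \<open>g\<close>.\<close>
      have "\<exists>u\<in>words n p. c u \<noteq> 0" "\<exists>w\<in>words n q. d w \<noteq> 0"
        using span_below_add_iff[OF cd(1), of "combination (words n p) c"] f
          span_below_add_iff[OF cd(2), of "combination (words n q) d"] g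
        by (auto simp: combination_words_in_span_below_iff)
      hence "f * g \<notin> span_below (p + q)"
        using R mult_in_span_below_iff[OF cd] by blast
      moreover have "f * g \<in> span_below (Suc (p + q))"
        using f g span_below_mult[of f "Suc p" g "Suc q"] by simp
      ultimately show ?thesis
        using f g by (simp add: degree_eqI)
    qed
  qed
  thus ?L
    by (simp add: degree_function_def pseudo_valuation_degree)
qed

end

theorem theorem3p6:
  fixes n :: nat
    and \<sigma> :: "'a::ring_1 \<Rightarrow> 'a mat"
    and \<delta> :: "'a \<Rightarrow> 'a vec"
    and \<iota> :: "'a \<Rightarrow> 's::ring_1"
    and x :: "nat \<Rightarrow> 's"
  assumes "n > 0"
    and "is_mat_hom n \<sigma>"
    and "is_right_derivation n \<sigma> \<delta>"
    and "is_free_skew_extension n \<sigma> \<delta> \<iota> x"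
  shows "degree_function (skew_degree \<iota> (x ` {..<n})) \<longleftrightarrow> megainjective n \<sigma>"
proof -
  interpret free_skew_extension n \<sigma> \<delta> \<iota> x
    by unfold_locales (rule assms(4))
  show ?thesis
    using degree_function_iff megainjective_iff[OF assms(2,1)] by blast
qed

end
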